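(* Suppose the counterfactual distribution $\mathrm{pr}(Y_0=\cdot\mid Z=1)$ is identifiable (so that both marginal distributions $\mathrm{pr}(Y_1=\cdot\mid Z=1)=\mathrm{pr}(Y=\cdot\mid Z=1)$ and $\mathrm{pr}(Y_0=\cdot\mid Z=1)$ are known), and suppose $0\le Y_1-Y_0\le 1$ (monotonic incremental treatment effect). Let $\omega_0=\{Y_0\in S\}$ with $S\subseteq\{0,\ldots,J-1\}$ be an event depending only on $Y_0$, with indicators $c_\ell=1$ if $\ell\in S$ and $c_\ell=0$ otherwise. Then $\mathrm{PN}(\omega_0,y)=\mathrm{pr}(\omega_0\mid Z=1,Y=y)$ is identifiable, and is given by $$\mathrm{PN}(\omega_0,y)=c_y+\frac{(c_{y-1}-c_y)\,\delta_{y\mid 1}}{\mathrm{pr}(Y=y\mid Z=1)},$$ where $\delta_{y\mid 1}=\sum_{j=0}^{y-1}\{\mathrm{pr}(Y_0=j\mid Z=1)-\mathrm{pr}(Y_1=j\mid Z=1)\}$.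
   Context: $Z\in\{0,1\}$ is a binary treatment, and $Y$ is an observed ordinal outcome with levels $0,\ldots,J-1$ ($J\ge 2$). $Y_1,Y_0\in\{0,\ldots,J-1\}$ are the potential outcomes under treatment and control, all on a common probability space, and $Y=Y_z$ on $\{Z=z\}$. The level $y\in\{0,\ldots,J-1\}$ satisfies $\mathrm{pr}(Z=1,Y=y)>0$, so that the conditional probability is defined. For $y=0$ the empty sum $\delta_{0\mid 1}$ equals $0$ and $c_{-1}$ may be taken as $0$. "Identifiable" means uniquely determined by the known marginal distributions $\mathrm{pr}(Y_1=\cdot\mid Z=1)$ and $\mathrm{pr}(Y_0=\cdot\mid Z=1)$. Inequalities between random variables hold at the individual level (for all units). *)

theory Defs
  imports "HOL-Probability.Probability"
begin

record 'a po_model =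
  prob_sp :: "'a measure"
  treat :: "'a \<Rightarrow> nat"
  pot1 :: "'a \<Rightarrow> nat"
  pot0 :: "'a \<Rightarrow> nat"
  obs :: "'a \<Rightarrow> nat"

text \<open>Measurability into a counting space also confines the values to that space, so the
  ranges of the treatment and of the three outcomes need no separate assumption.\<close>

definition po_model :: "nat \<Rightarrow> 'a po_model \<Rightarrow> bool" where
  "po_model J m \<longleftrightarrow>
     prob_space (prob_sp m) \<and>
     treat m \<in> measurable (prob_sp m) (count_space {0, 1}) \<and>
     pot1 m \<in> measurable (prob_sp m) (count_space {0..<J}) \<and>
     pot0 m \<in> measurable (prob_sp m) (count_space {0..<J}) \<and>
     obs m \<in> measurable (prob_sp m) (count_space {0..<J}) \<and>
     (\<forall>\<omega>\<in>space (prob_sp m).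
        (treat m \<omega> = 1 \<longrightarrow> obs m \<omega> = pot1 m \<omega>) \<and>
        (treat m \<omega> = 0 \<longrightarrow> obs m \<omega> = pot0 m \<omega>))"

definition monotonic_incremental :: "'a po_model \<Rightarrow> bool" where
  "monotonic_incremental m \<longleftrightarrow>
     (\<forall>\<omega>\<in>space (prob_sp m).
        0 \<le> int (pot1 m \<omega>) - int (pot0 m \<omega>) \<and> int (pot1 m \<omega>) - int (pot0 m \<omega>) \<le> 1)"

definition marg1 :: "'a po_model \<Rightarrow> nat \<Rightarrow> real" where
  "marg1 m j = \<P>(\<omega> in prob_sp m. pot1 m \<omega> = j \<bar> treat m \<omega> = 1)"

definition marg0 :: "'a po_model \<Rightarrow> nat \<Rightarrow> real" where
  "marg0 m j = \<P>(\<omega> in prob_sp m. pot0 m \<omega> = j \<bar> treat m \<omega> = 1)"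

definition marg_obs :: "'a po_model \<Rightarrow> nat \<Rightarrow> real" where
  "marg_obs m j = \<P>(\<omega> in prob_sp m. obs m \<omega> = j \<bar> treat m \<omega> = 1)"

definition PN :: "'a po_model \<Rightarrow> 'a set \<Rightarrow> nat \<Rightarrow> real" where
  "PN m E y = \<P>(\<omega> in prob_sp m. \<omega> \<in> E \<bar> treat m \<omega> = 1 \<and> obs m \<omega> = y)"

definition event0 :: "'a po_model \<Rightarrow> nat set \<Rightarrow> 'a set" where
  "event0 m S = {\<omega> \<in> space (prob_sp m). pot0 m \<omega> \<in> S}"

text \<open>Indexed by integers so that index \<open>-1\<close> is meaningful; its value there is \<open>0\<close>.\<close>

definition level_ind :: "nat set \<Rightarrow> int \<Rightarrow> real" where
  "level_ind S l = (if l \<in> int ` S then 1 else 0)"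

definition delta :: "'a po_model \<Rightarrow> nat \<Rightarrow> real" where
  "delta m y = (\<Sum>j\<in>{0..<y}. marg0 m j - marg1 m j)"

definition admissible :: "nat \<Rightarrow> nat \<Rightarrow> 'a po_model \<Rightarrow> bool" where
  "admissible J y m \<longleftrightarrow>
     po_model J m \<and> monotonic_incremental m \<and>
     \<P>(\<omega> in prob_sp m. treat m \<omega> = 1 \<and> obs m \<omega> = y) > 0"

text \<open>Identifiability: any two admissible models with the same two marginals among the treated
  give the same value. The models may live on sample spaces of different types, which is why both
  types are parameters.\<close>

definition PN_identifiable :: "'a itself \<Rightarrow> 'b itself \<Rightarrow> nat \<Rightarrow> nat set \<Rightarrow> nat \<Rightarrow> bool" where
  "PN_identifiable TA TB J S y \<longleftrightarrow>
     (\<forall>(m :: 'a po_model) (m' :: 'b po_model).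
        admissible J y m \<and> admissible J y m' \<and>
        (\<forall>j\<in>{0..<J}. marg1 m j = marg1 m' j) \<and>
        (\<forall>j\<in>{0..<J}. marg0 m j = marg0 m' j) \<longrightarrow>
        PN m (event0 m S) y = PN m' (event0 m' S) y)"

end

theory Submission imports Defs begin

text \<open>Write \<open>B = {Z = 1, Y\<^sub>0 < y \<le> Y\<^sub>1}\<close> for the treated units that cross the level \<open>y\<close>.
  Since \<open>Y\<^sub>0 \<le> Y\<^sub>1\<close>, the events \<open>{Y\<^sub>1 < y} \<subseteq> {Y\<^sub>0 < y}\<close> differ among the treated by exactly \<open>B\<close>,
  so \<open>\<delta>\<close> is the conditional probability of \<open>B\<close> given \<open>Z = 1\<close>. Since moreover \<open>Y\<^sub>1 \<le> Y\<^sub>0 + 1\<close>,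
  \<open>B = {Z = 1, Y\<^sub>1 = y, Y\<^sub>0 = y - 1}\<close>, and on the rest of \<open>{Z = 1, Y\<^sub>1 = y}\<close> we have \<open>Y\<^sub>0 = y\<close>.
  Hence \<open>B\<close> alone determines the law of \<open>Y\<^sub>0\<close> given \<open>Z = 1, Y = y\<close>.\<close>

text \<open>Serves the measurability prover: with \<open>count_space UNIV\<close> as target,
  comparisons such as \<open>Y0 < y\<close> are recognised as measurable events.\<close>

lemma measurable_count_space_UNIV:
  assumes "f \<in> measurable M (count_space A)"
  shows "f \<in> measurable M (count_space UNIV)"
  using measurable_compose[OF assms, of "\<lambda>x. x" "count_space UNIV"] by simp

lemma (in prob_space) sum_cond_prob_eq_less:
  fixes X :: "'a \<Rightarrow> nat"
  assumes [measurable]: "X \<in> measurable M (count_space UNIV)" "Measurable.pred M Q"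
  shows "(\<Sum>j\<in>{0..<n}. \<P>(x in M. X x = j \<bar> Q x)) = \<P>(x in M. X x < n \<bar> Q x)"
proof -
  have "(\<Sum>j\<in>{0..<n}. \<P>(x in M. X x = j \<and> Q x)) = \<P>(x in M. X x < n \<and> Q x)"
    by (subst finite_measure_finite_Union[symmetric])
      (auto simp: disjoint_family_on_def intro!: arg_cong[where f = "measure M"])
  then show ?thesis
    by (simp add: cond_prob_def sum_divide_distrib[symmetric])
qed

lemma po_model_measurable:
  assumes "po_model J m"
  shows "treat m \<in> measurable (prob_sp m) (count_space UNIV)"
    and "pot1 m \<in> measurable (prob_sp m) (count_space UNIV)"
    and "pot0 m \<in> measurable (prob_sp m) (count_space UNIV)"
    and "obs m \<in> measurable (prob_sp m) (count_space UNIV)"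
  using assms by (auto simp: po_model_def intro: measurable_count_space_UNIV)

lemma level_ind_of_nat: "level_ind S (int l) = (if l \<in> S then 1 else 0)"
  by (auto simp: level_ind_def)

text \<open>Consistency makes the two events coincide among the treated. This turns the denominator
  of the formula into one of the known marginals.\<close>

lemma marg_obs_eq_marg1:
  assumes "po_model J m"
  shows "marg_obs m = marg1 m"
proof
  fix j
  have "{\<omega> \<in> space (prob_sp m). obs m \<omega> = j \<and> treat m \<omega> = 1} =
      {\<omega> \<in> space (prob_sp m). pot1 m \<omega> = j \<and> treat m \<omega> = 1}"
    using assms by (auto simp: po_model_def)
  then show "marg_obs m j = marg1 m j"
    by (simp add: marg_obs_def marg1_def cond_prob_def)
qed

lemma delta_eq_cond_prob_crossing:
  assumes "po_model J m" and "monotonic_incremental m"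
  shows "delta m y = \<P>(\<omega> in prob_sp m. pot0 m \<omega> < y \<and> y \<le> pot1 m \<omega> \<bar> treat m \<omega> = 1)"
proof -
  let ?M = "prob_sp m"
  interpret prob_space ?M using assms by (simp add: po_model_def)
  note [measurable] = po_model_measurable[OF assms(1)]
  have "{\<omega> \<in> space ?M. (pot0 m \<omega> < y \<and> y \<le> pot1 m \<omega>) \<and> treat m \<omega> = 1} =
      {\<omega> \<in> space ?M. pot0 m \<omega> < y \<and> treat m \<omega> = 1} -
      {\<omega> \<in> space ?M. pot1 m \<omega> < y \<and> treat m \<omega> = 1}"
    by auto
  \<comment> \<open>The lower bound Y0 \<le> Y1 enters here: it gives the inclusion under which the
    measure of a difference is the difference of measures.\<close>
  also have "prob \<dots> = \<P>(\<omega> in ?M. pot0 m \<omega> < y \<and> treat m \<omega> = 1) -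
      \<P>(\<omega> in ?M. pot1 m \<omega> < y \<and> treat m \<omega> = 1)"
    using assms(2) by (intro finite_measure_Diff) (force simp: monotonic_incremental_def)+
  finally have diff: "\<P>(\<omega> in ?M. (pot0 m \<omega> < y \<and> y \<le> pot1 m \<omega>) \<and> treat m \<omega> = 1) =
      \<P>(\<omega> in ?M. pot0 m \<omega> < y \<and> treat m \<omega> = 1) - \<P>(\<omega> in ?M. pot1 m \<omega> < y \<and> treat m \<omega> = 1)" .
  have "delta m y = \<P>(\<omega> in ?M. pot0 m \<omega> < y \<bar> treat m \<omega> = 1) -
      \<P>(\<omega> in ?M. pot1 m \<omega> < y \<bar> treat m \<omega> = 1)"
    unfolding delta_def marg0_def marg1_def sum_subtractf
    by (subst (1 2) sum_cond_prob_eq_less) simp_all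
  then show ?thesis
    unfolding cond_prob_def diff diff_divide_distrib .
qed

lemma PN_event0_formula:
  assumes "admissible J y m"
  shows "PN m (event0 m S) y =
    level_ind S (int y) +
    (level_ind S (int y - 1) - level_ind S (int y)) * delta m y / marg_obs m y"
proof -
  let ?M = "prob_sp m"
  have m: "po_model J m" and inc: "monotonic_incremental m"
    and pos: "\<P>(\<omega> in ?M. treat m \<omega> = 1 \<and> obs m \<omega> = y) > 0"
    using assms by (auto simp: admissible_def)
  interpret prob_space ?M using m by (simp add: po_model_def)
  note [measurable] = po_model_measurable[OF m]
  define T where "T = {\<omega> \<in> space ?M. treat m \<omega> = 1}"
  define A where "A = {\<omega> \<in> space ?M. treat m \<omega> = 1 \<and> obs m \<omega> = y}"
  define B where "B = {\<omega> \<in> space ?M. (pot0 m \<omega> < y \<and> y \<le> pot1 m \<omega>) \<and> treat m \<omega> = 1}"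
  define E where "E = {\<omega> \<in> space ?M. pot0 m \<omega> \<in> S}"
  have [measurable]: "T \<in> events" "A \<in> events" "B \<in> events" "E \<in> events"
    unfolding T_def A_def B_def E_def by measurable
  have A: "prob A > 0" using pos by (simp add: A_def)
  \<comment> \<open>Both \<open>delta\<close> and \<open>marg_obs\<close> carry the denominator
    \<open>prob T\<close>; its positivity lets it cancel in their quotient at the end.\<close>
  have "prob A \<le> prob T"
    by (rule finite_measure_mono) (auto simp: A_def T_def)
  with A have T: "prob T > 0" by linarith
  have obs: "obs m \<omega> = pot1 m \<omega>" if "\<omega> \<in> space ?M" "treat m \<omega> = 1" for \<omega>
    using m that by (auto simp: po_model_def)
  have step: "pot0 m \<omega> \<le> pot1 m \<omega>" "pot1 m \<omega> \<le> Suc (pot0 m \<omega>)" if "\<omega> \<in> space ?M" for \<omega>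
    using inc that by (force simp: monotonic_incremental_def)+
  have AB: "B \<subseteq> A" using step by (fastforce simp: A_def B_def obs)
  have on_B: "int (pot0 m \<omega>) = int y - 1" if "\<omega> \<in> B" for \<omega>
    using that step[of \<omega>] by (auto simp: B_def)
  have on_A: "pot0 m \<omega> = y" if "\<omega> \<in> A - B" for \<omega>
    using that step[of \<omega>] by (auto simp: A_def B_def obs)
  have EB: "prob (E \<inter> B) = level_ind S (int y - 1) * prob B"
  \<comment> \<open>The empty case covers y = 0, where the index is -1. A point of \<open>B\<close>
    forces y > 0, so integer and natural subtraction agree.\<close>
  proof (cases "B = {}")
    case False
    then obtain \<omega> where "\<omega> \<in> B" by auto
    have "y > 0" using \<open>\<omega> \<in> B\<close> by (auto simp: B_def)
    then have y: "int y - 1 = int (y - 1)" by simp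
    have "E \<inter> B = (if y - 1 \<in> S then B else {})"
      using on_B by (auto simp: E_def y) (auto simp: B_def)
    then show ?thesis unfolding y level_ind_of_nat by auto
  qed simp
  \<comment> \<open>Y0 is constant on this piece, so \<open>E\<close> contains all of it or misses
    it.\<close>
  have "E \<inter> (A - B) = (if y \<in> S then A - B else {})"
    using on_A by (auto simp: E_def) (auto simp: A_def)
  then have EA: "prob (E \<inter> (A - B)) = level_ind S (int y) * (prob A - prob B)"
    using AB by (simp add: level_ind_of_nat finite_measure_Diff)
  have "E \<inter> A = (E \<inter> B) \<union> (E \<inter> (A - B))" using AB by auto
  also have "prob \<dots> = prob (E \<inter> B) + prob (E \<inter> (A - B))"
    by (rule finite_measure_Union) auto
  finally have EA': "prob (E \<inter> A) = level_ind S (int y - 1) * prob B +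
      level_ind S (int y) * (prob A - prob B)"
    by (simp add: EB EA)
  have "{\<omega> \<in> space ?M. \<omega> \<in> event0 m S \<and> treat m \<omega> = 1 \<and> obs m \<omega> = y} = E \<inter> A"
    by (auto simp: event0_def E_def A_def)
  then have PN: "PN m (event0 m S) y = prob (E \<inter> A) / prob A"
    by (simp add: PN_def cond_prob_def A_def)
  have delta: "delta m y = prob B / prob T"
    by (simp add: delta_eq_cond_prob_crossing[OF m inc] cond_prob_def B_def T_def)
  have marg: "marg_obs m y = prob A / prob T"
    by (simp add: marg_obs_def cond_prob_def A_def T_def conj_commute)
  show ?thesis
    \<comment> \<open>PN is an average of the two indicators in which c_{y-1} has weight
      \<open>prob B / prob A\<close>, and this weight equals
      \<open>delta m y / marg_obs m y\<close>.\<close>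
    unfolding PN delta marg EA' using A T by (simp add: field_simps)
qed

theorem theorem1:
  fixes J y :: nat and S :: "nat set"
  assumes "J \<ge> 2" and "y \<in> {0..<J}" and "S \<subseteq> {0..<J}"
  shows "PN_identifiable TYPE('a) TYPE('b) J S y \<and>
    (\<forall>m :: 'a po_model. admissible J y m \<longrightarrow>
       PN m (event0 m S) y =
         level_ind S (int y) +
         (level_ind S (int y - 1) - level_ind S (int y)) * delta m y / marg_obs m y)"
proof
  show "PN_identifiable TYPE('a) TYPE('b) J S y"
    unfolding PN_identifiable_def
  proof (intro allI impI, elim conjE)
    fix m :: "'a po_model" and m' :: "'b po_model"
    assume m: "admissible J y m" and m': "admissible J y m'"
      and 1: "\<forall>j\<in>{0..<J}. marg1 m j = marg1 m' j"
      and 0: "\<forall>j\<in>{0..<J}. marg0 m j = marg0 m' j"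
    \<comment> \<open>Since y < J, the sum only involves levels at which the marginals are assumed
      to agree.\<close>
    have "delta m y = delta m' y"
      unfolding delta_def using 0 1 assms(2) by (intro sum.cong) auto
    moreover have "marg_obs m y = marg_obs m' y"
      using 1 assms(2) m m' by (auto simp: admissible_def marg_obs_eq_marg1)
    ultimately show "PN m (event0 m S) y = PN m' (event0 m' S) y"
      by (simp add: PN_event0_formula[OF m] PN_event0_formula[OF m'])
  qed
qed (simp add: PN_event0_formula)

end
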